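(* For every integer $n\ge 1$, the simple extension complexity of the perfect matching polytope of the complete graph $K_{2n}$ on $2n$ nodes is equal to its number of vertices $\frac{(2n)!}{n!\cdot 2^n}$.
   Context: The perfect matching polytope of a graph $G=(V,E)$ is the convex hull in $\mathbb{R}^E$ of the characteristic vectors $\chi(M)\in\{0,1\}^E$ of all perfect matchings $M$ in $G$. An extension of a polytope $P$ is a polytope $Q$ together with a linear map $\pi$ (a projection) with $\pi(Q)=P$. The size of a polytope is its number of facets. Faces of a polytope include the empty face (of dimension $-1$) and the polytope itself; a facet is a face of dimension one less than the polytope (so a single point has exactly one facet, the empty face). A $d$-dimensional polytope is simple if every vertex is contained in exactly $d$ facets. The simple extension complexity $\operatorname{sxc}(P)$ is the smallest size of any simple polytope $Q$ that is an extension of $P$. *)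

theory Defs
  imports "HOL-Analysis.Analysis" "HOL-Analysis.Finite_Function_Topology"
begin

section \<open>Facets, simple polytopes, simple extension complexity\<close>

text \<open>
  The library's \<^term>\<open>aff_dim\<close> is restricted to the class \<^class>\<open>euclidean_space\<close>.
  An extension of a polytope may live in a space of any finite dimension, so polytopes in the
  infinite-dimensional space \<^typ>\<open>nat \<Rightarrow>\<^sub>0 real\<close> are used below, and the dimension is defined over any
  real vector space, as that of the direction space of the affine hull.
\<close>

definition affdim :: "'a::real_vector set \<Rightarrow> int" where
  "affdim S = (if S = {} then -1 else int (dim {x - y | x y. x \<in> S \<and> y \<in> S}))"

lemma affdim_eq_aff_dim: "affdim S = aff_dim S" for S :: "'a::euclidean_space set"
proof (cases "S = {}")
  case True
  then show ?thesis by (simp add: affdim_def)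
next
  case False
  then obtain a where a: "a \<in> S" by blast
  let ?D = "{x - y | x y. x \<in> S \<and> y \<in> S}" and ?A = "(\<lambda>x. x - a) ` S"
  have "?D \<subseteq> span ?A"
  proof clarify
    fix x y assume "x \<in> S" "y \<in> S"
    then have "(x - a) - (y - a) \<in> span ?A"
      by (intro span_diff span_base) auto
    then show "x - y \<in> span ?A" by simp
  qed
  moreover have "?A \<subseteq> ?D" using a by auto
  ultimately have "span ?D = span ?A"
    using span_mono span_minimal[OF _ subspace_span] by (intro subset_antisym)
  then have "dim ?D = dim ?A" by (rule span_eq_dim)
  then show ?thesis
    using False a by (simp add: affdim_def aff_dim_eq_dim_subtract[of a S] hull_inc)
qed

text \<open>
  Unlike for the library's \<^const>\<open>facet_of\<close>, the empty face (of dimension -1) counts as a facet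
  of a single point.
\<close>

definition facets :: "'a::real_vector set \<Rightarrow> 'a set set" where
  "facets P = {F. F face_of P \<and> affdim F = affdim P - 1}"

definition polytope_size :: "'a::real_vector set \<Rightarrow> nat" where
  "polytope_size P = card (facets P)"

definition simple_polytope :: "'a::real_vector set \<Rightarrow> bool" where
  "simple_polytope Q \<longleftrightarrow> polytope Q \<and>
     (\<forall>v. v extreme_point_of Q \<longrightarrow> int (card {F \<in> facets Q. v \<in> F}) = affdim Q)"

definition extension_via ::
    "'a::real_vector set \<Rightarrow> ('a \<Rightarrow> 'b::real_vector) \<Rightarrow> 'b set \<Rightarrow> bool" where
  "extension_via Q \<pi> P \<longleftrightarrow> polytope Q \<and> linear \<pi> \<and> \<pi> ` Q = P"

text \<open>
  The extensions \<open>Q\<close> range over the polytopes in \<^typ>\<open>nat \<Rightarrow>\<^sub>0 real\<close>, the space of finitely supported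
  real sequences. As the union of the spaces of sequences supported in \<open>{..<d}\<close>, it contains
  a copy of every space of finite dimension \<open>d\<close>, and each polytope in it lies in one of these
  copies; every linear map on such a copy extends linearly to the whole space. So this is the
  minimum over all simple extensions in all finite dimensions; lemma \<open>sxc_le\<close> below confirms
  that extensions in arbitrary Euclidean spaces are covered.
\<close>

definition sxc :: "'b::real_vector set \<Rightarrow> nat" where
  "sxc P = (LEAST k. \<exists>(Q :: (nat \<Rightarrow>\<^sub>0 real) set) \<pi>.
     simple_polytope Q \<and> extension_via Q \<pi> P \<and> polytope_size Q = k)"

lemma affdim_linear_image:
  fixes f :: "'a::real_vector \<Rightarrow> 'b::real_vector"
  assumes f: "linear f" "inj f"
  shows "affdim (f ` S) = affdim S"
proof -
  interpret linear f by fact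
  let ?D = "{x - y | x y. x \<in> S \<and> y \<in> S}"
  have im: "{x - y | x y. x \<in> f ` S \<and> y \<in> f ` S} = f ` ?D"
  proof (intro set_eqI iffI)
    fix z assume "z \<in> {x - y | x y. x \<in> f ` S \<and> y \<in> f ` S}"
    then obtain x y where "x \<in> S" "y \<in> S" "z = f (x - y)" by (auto simp: diff)
    then show "z \<in> f ` ?D" by blast
  next
    fix z assume "z \<in> f ` ?D"
    then obtain x y where "x \<in> S" "y \<in> S" "z = f x - f y" by (auto simp: diff)
    then show "z \<in> {x - y | x y. x \<in> f ` S \<and> y \<in> f ` S}" by blast
  qed
  obtain B where B: "B \<subseteq> ?D" "independent B" "?D \<subseteq> span B"
    using real_vector.maximal_independent_subset by blast
  have iB: "independent (f ` B)"
    by (rule linear_independent_injective_image[OF f(1) B(2) inj_on_subset[OF f(2) subset_UNIV]])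
  have "dim (f ` ?D) = card (f ` B)"
  proof (rule real_vector.dim_eq_card[OF _ iB])
    have "span (f ` B) = f ` span B" "span (f ` ?D) = f ` span ?D"
      by (simp_all only: linear_span_image[OF f(1)])
    moreover have "span B = span ?D"
      using span_mono[OF B(1)] span_minimal[OF B(3) subspace_span] by (rule subset_antisym)
    ultimately show "span (f ` B) = span (f ` ?D)" by simp
  qed
  moreover have "card (f ` B) = card B"
    by (rule card_image[OF inj_on_subset[OF f(2) subset_UNIV]])
  moreover have "dim ?D = card B"
    by (rule real_vector.dim_unique[OF B(1) B(3) B(2) refl])
  ultimately show ?thesis
    by (simp add: affdim_def im)
qed

lemma facets_linear_image:
  fixes f :: "'a::real_vector \<Rightarrow> 'b::real_vector"
  assumes f: "linear f" "inj f"
  shows "facets (f ` S) = (`) f ` facets S"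
proof (intro set_eqI iffI)
  fix F assume F: "F \<in> facets (f ` S)"
  then have "F \<subseteq> f ` S" by (simp add: facets_def face_of_imp_subset)
  then obtain G where "F = f ` G" by (rule subset_imageE)
  with F show "F \<in> (`) f ` facets S"
    using f by (auto simp: facets_def face_of_linear_image affdim_linear_image)
next
  fix F assume "F \<in> (`) f ` facets S"
  then show "F \<in> facets (f ` S)"
    using f by (auto simp: facets_def face_of_linear_image affdim_linear_image)
qed

lemma polytope_size_linear_image:
  fixes f :: "'a::real_vector \<Rightarrow> 'b::real_vector"
  assumes "linear f" "inj f"
  shows "polytope_size (f ` S) = polytope_size S"
proof -
  have "inj_on ((`) f) (facets S)"
    using assms(2) by (simp add: inj_on_def inj_image_eq_iff)
  then show ?thesis
    by (simp add: polytope_size_def facets_linear_image[OF assms] card_image)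
qed

lemma simple_polytope_linear_image:
  fixes f :: "'a::real_vector \<Rightarrow> 'b::real_vector"
  assumes f: "linear f" "inj f" and S: "simple_polytope S"
  shows "simple_polytope (f ` S)"
  unfolding simple_polytope_def
proof (intro conjI allI impI)
  show "polytope (f ` S)"
    using S f(1) by (simp add: simple_polytope_def polytope_linear_image)
  fix v assume v: "v extreme_point_of f ` S"
  then obtain w where w: "w \<in> S" "v = f w" by (auto simp: extreme_point_of_def)
  have "w extreme_point_of S"
    using v w f by (auto simp: extreme_point_of_def open_segment_linear_image)
  then have "int (card {F \<in> facets S. w \<in> F}) = affdim S"
    using S by (simp add: simple_polytope_def)
  moreover have "{F \<in> facets (f ` S). v \<in> F} = (`) f ` {F \<in> facets S. w \<in> F}"
    using inj_image_mem_iff[OF f(2)] by (simp add: facets_linear_image[OF f] w) blast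
  moreover have "inj_on ((`) f) {F \<in> facets S. w \<in> F}"
    using f(2) by (simp add: inj_on_def inj_image_eq_iff)
  ultimately show "int (card {F \<in> facets (f ` S). v \<in> F}) = affdim (f ` S)"
    by (simp add: card_image affdim_linear_image[OF f])
qed

lemma lookup_scaleR_real: "Poly_Mapping.lookup (c *\<^sub>R p) i = c * Poly_Mapping.lookup p i"
  for p :: "nat \<Rightarrow>\<^sub>0 real"
proof -
  have "finite {i. c *\<^sub>R Poly_Mapping.lookup p i \<noteq> 0}"
    by (rule finite_subset[OF _ finite_lookup[of p]]) auto
  then show ?thesis
    by (simp add: scaleR_poly_mapping_def)
qed

lemma sxc_le:
  fixes Q :: "'a::euclidean_space set" and P :: "'b::real_vector set"
  assumes Q: "simple_polytope Q" and ext: "extension_via Q \<pi> P"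
  shows "sxc P \<le> polytope_size Q"
proof -
  obtain ix :: "'a \<Rightarrow> nat" where ix: "inj_on ix Basis"
    using finite_imp_inj_to_nat_seg[OF finite_Basis] by blast
  define f :: "'a \<Rightarrow> (nat \<Rightarrow>\<^sub>0 real)"
    where "f x = (\<Sum>b\<in>Basis. Poly_Mapping.single (ix b) (x \<bullet> b))" for x
  have look: "Poly_Mapping.lookup (f x) i = (\<Sum>b\<in>Basis. (x \<bullet> b) when ix b = i)" for x i
    by (simp add: f_def lookup_sum lookup_single)
  have lin: "linear f"
  proof (rule linearI; rule poly_mapping_eqI)
    show "Poly_Mapping.lookup (f (x + y)) i = Poly_Mapping.lookup (f x + f y) i" for x y i
      by (auto simp: look lookup_add inner_add_left when_def sum.distrib[symmetric] intro!: sum.cong)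
    show "Poly_Mapping.lookup (f (c *\<^sub>R x)) i = Poly_Mapping.lookup (c *\<^sub>R f x) i" for c x i
      by (auto simp: look lookup_scaleR_real when_def sum_distrib_left intro!: sum.cong)
  qed
  have coord: "Poly_Mapping.lookup (f x) (ix b) = x \<bullet> b" if "b \<in> Basis" for x b
  proof -
    have "(\<Sum>c\<in>Basis. (x \<bullet> c) when ix c = ix b) = (\<Sum>c\<in>Basis. if c = b then x \<bullet> c else 0)"
      using ix that by (intro sum.cong) (auto simp: when_def inj_on_def)
    then show ?thesis using that by (simp add: look)
  qed
  have inj: "inj f"
  proof (rule injI)
    fix x y assume "f x = f y"
    then have "x \<bullet> b = y \<bullet> b" if "b \<in> Basis" for b
      using coord[OF that, of x] coord[OF that, of y] by simp
    then show "x = y" by (rule euclidean_eqI)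
  qed
  obtain g where g: "linear g" "g \<circ> f = id"
    using linear_injective_left_inverse[OF lin inj] by blast
  have "linear (\<pi> \<circ> g)"
    using ext g by (auto simp: extension_via_def intro: linear_compose)
  moreover have "(\<pi> \<circ> g) ` f ` Q = \<pi> ` Q"
    using g(2) by (simp add: image_image fun_eq_iff)
  moreover have s: "simple_polytope (f ` Q)"
    by (rule simple_polytope_linear_image[OF lin inj Q])
  ultimately have "extension_via (f ` Q) (\<pi> \<circ> g) P"
    using ext by (simp add: extension_via_def simple_polytope_def)
  then show ?thesis
    unfolding sxc_def
    by (intro Least_le exI[of _ "f ` Q"] exI[of _ "\<pi> \<circ> g"] conjI s
        polytope_size_linear_image[OF lin inj])
qed

section \<open>Perfect matching polytopes\<close>

text \<open>A graph has node set \<open>V\<close> and an edge set \<open>E\<close> of two-element subsets of \<open>V\<close>.\<close>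

definition complete_edges :: "'v set \<Rightarrow> 'v set set" where
  "complete_edges V = {e. e \<subseteq> V \<and> card e = 2}"

definition perfect_matching :: "'v set \<Rightarrow> 'v set set \<Rightarrow> 'v set set \<Rightarrow> bool" where
  "perfect_matching V E M \<longleftrightarrow> M \<subseteq> E \<and> (\<forall>v\<in>V. \<exists>!e. e \<in> M \<and> v \<in> e)"

text \<open>
  The space of real vectors indexed by \<open>E\<close> is taken as the coordinate subspace of
  \<^typ>\<open>real ^ ('v set)\<close> whose coordinates outside \<open>E\<close> vanish.
\<close>

definition char_vec :: "'v::finite set set \<Rightarrow> real ^ ('v set)" where
  "char_vec M = (\<chi> e. if e \<in> M then 1 else 0)"

definition perfect_matching_polytope ::
    "'v::finite set \<Rightarrow> 'v set set \<Rightarrow> (real ^ ('v set)) set" where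
  "perfect_matching_polytope V E = convex hull (char_vec ` {M. perfect_matching V E M})"

end

theory Submission
  imports Defs
begin

text \<open>
The characteristic vectors of the perfect matchings are the vertices of the polytope \<open>P\<close>, because
they are 0/1-vectors. A simplex with as many vertices is simple, has as many facets and projects
onto \<open>P\<close>; this is the upper bound (\<open>simplex_extension\<close>).

For the lower bound, let \<open>Q\<close> be a simple extension of \<open>P\<close>. Every face \<open>G\<close> of \<open>P\<close> has a preimage in
\<open>Q\<close>, which is a face of \<open>Q\<close>. Simplicity enters in the following way (\<open>simple_vertex_prime_facet\<close>):
if two faces of \<open>Q\<close> share a vertex and a facet through this vertex contains their
intersection, then it contains one of them. Indeed, just one edge at the vertex leaves the facet,
and every face at the vertex that is not contained in the facet includes this edge.

Given a perfect matching \<open>w\<close> on at least four nodes, choose a perfect matching \<open>x\<close> such that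
\<open>x \<union> w\<close> is a Hamiltonian cycle, and a facet \<open>\<Phi>\<close> of \<open>Q\<close> that contains the preimage of
\<open>x\<close> but not that of \<open>w\<close>. For any perfect matching \<open>u\<close> other than \<open>w\<close>, the perfect
matchings contained in \<open>x \<union> u\<close> span a face of \<open>P\<close>. It meets the edge from \<open>x\<close> to \<open>w\<close> only in \<open>x\<close>,
because \<open>w\<close> is disjoint from \<open>x\<close> and so is not contained in \<open>x \<union> u\<close>. Since the preimage of the
edge is not contained in \<open>\<Phi>\<close>, that of the face is, and in particular that of \<open>u\<close>. So the
preimages contained in \<open>\<Phi>\<close> are those of all matchings but \<open>w\<close>, and different choices of \<open>w\<close> give
different facets (\<open>simple_extension_size_ge\<close>, \<open>pmp_extension_size_ge\<close>). On two nodes \<open>P\<close> is a point,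
and \<open>Q\<close> has at least one facet.

The extensions live in an infinite-dimensional space. But the dimension of a simple polytope is at
most its number of facets, so a counterexample \<open>Q\<close> with fewer facets than there are matchings has
a copy in a Euclidean space of a dimension known in advance (\<open>polytope_in_euclidean_copy\<close>).
\<close>

section \<open>Faces of polytopes in real vector spaces\<close>

lemma polytope_has_extreme_point:
  fixes S :: "'a::real_vector set"
  assumes "polytope S" "S \<noteq> {}"
  obtains x where "x extreme_point_of S"
proof -
  obtain X0 where "finite X0 \<and> S = convex hull X0" using assms(1) by (auto simp: polytope_def)
  then obtain X where X: "finite X" "S = convex hull X"
      and min: "\<And>Y. finite Y \<and> S = convex hull Y \<Longrightarrow> card X \<le> card Y"
    using arg_min_natI[of "\<lambda>X. finite X \<and> S = convex hull X" X0 card]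
      arg_min_nat_le[of "\<lambda>X. finite X \<and> S = convex hull X" _ card] by metis
  obtain x where x: "x \<in> X" using X(2) assms(2) by auto
  \<comment> \<open>A generator in a smallest generating set is not a convex combination of the others.\<close>
  have "x \<notin> convex hull (X - {x})"
  proof
    assume "x \<in> convex hull (X - {x})"
    then have "S = convex hull (X - {x})"
      using X(2) x hull_redundant[of x convex "X - {x}"] by (simp add: insert_absorb)
    with min[of "X - {x}"] X(1) x show False by (simp add: card_gt_0_iff)
       (metis card_Diff1_less not_le card_Diff_singleton One_nat_def)
  qed
  with extreme_point_of_convex_hull_insert[of "X - {x}" x] X x show thesis
    by (intro that[of x]) (simp add: insert_absorb)
qed

lemma face_of_convex_hull_finite_eq:
  fixes X :: "'a::real_vector set"
  assumes X: "finite X" and F: "F face_of convex hull X"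
  shows "F = convex hull (X \<inter> F)"
proof
  show "convex hull (X \<inter> F) \<subseteq> F"
    by (intro hull_minimal) (use F face_of_imp_convex in auto)
  show "F \<subseteq> convex hull (X \<inter> F)"
  proof
    fix z assume z: "z \<in> F"
    then have "z \<in> convex hull X" using F face_of_imp_subset by blast
    then obtain u where u: "\<And>x. x \<in> X \<Longrightarrow> 0 \<le> u x" "sum u X = 1" "(\<Sum>x\<in>X. u x *\<^sub>R x) = z"
      unfolding convex_hull_finite[OF X] by blast
    \<comment> \<open>A generator off \<open>F\<close> with positive weight would make \<open>z\<close> an inner point of a segment with an end off \<open>F\<close>.\<close>
    have zero: "u x = 0" if x: "x \<in> X" "x \<notin> F" for x
    proof (rule ccontr)
      assume nz: "u x \<noteq> 0"
      have split: "z = u x *\<^sub>R x + (\<Sum>y\<in>X - {x}. u y *\<^sub>R y)" "u x + sum u (X - {x}) = 1"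
        using u x X by (simp_all add: sum.remove)
      show False
      proof (cases "u x = 1")
        case True
        then have "sum u (X - {x}) = 0" using split by simp
        then have "\<forall>y\<in>X - {x}. u y = 0" using u(1) X by (subst (asm) sum_nonneg_eq_0_iff) auto
        then have "z = x" using split True by simp
        with z x show False by simp
      next
        case False
        have pos: "0 < u x" "0 < 1 - u x"
          using False nz u(1)[OF x(1)] split(2) sum_nonneg[of "X - {x}" u] u(1) by force+
        define y where "y = (\<Sum>y\<in>X - {x}. (u y / (1 - u x)) *\<^sub>R y)"
        have "y \<in> convex hull X" unfolding y_def
        proof (rule convex_sum)
          show "(\<Sum>i\<in>X - {x}. u i / (1 - u x)) = 1"
            using split(2) pos(2) by (simp flip: sum_divide_distrib)
        qed (use X u(1) pos in \<open>auto simp: hull_inc\<close>)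
        moreover have zy: "z = (1 - u x) *\<^sub>R y + u x *\<^sub>R x"
          unfolding split(1) y_def scaleR_sum_right using pos(2) by simp
        moreover have "x \<in> convex hull X" using x by (simp add: hull_inc)
        moreover have "y \<noteq> x"
          using zy z x by (auto simp flip: scaleR_left_distrib)
        moreover have "z \<in> open_segment y x"
          unfolding in_segment using zy \<open>y \<noteq> x\<close> pos by auto
        ultimately show False using F z x(2) by (auto simp: face_of_def)
      qed
    qed
    have "sum u (X \<inter> F) = sum u X" "(\<Sum>x\<in>X \<inter> F. u x *\<^sub>R x) = (\<Sum>x\<in>X. u x *\<^sub>R x)"
      by (rule sum.mono_neutral_left; use zero X in auto)+
    then have "sum u (X \<inter> F) = 1" "z = (\<Sum>x\<in>X \<inter> F. u x *\<^sub>R x)" using u(2,3) by simp_all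
    note this(2)
    also have "\<dots> \<in> convex hull (X \<inter> F)"
      using X u(1) \<open>sum u (X \<inter> F) = 1\<close> by (intro convex_sum) (auto simp: hull_inc)
    finally show "z \<in> convex hull (X \<inter> F)" .
  qed
qed

text \<open>
Needed because the cardinality of an infinite set is 0, which would make \<^const>\<open>polytope_size\<close>
meaningless as a bound.
\<close>

lemma finite_facets_polytope:
  fixes S :: "'a::real_vector set"
  assumes "polytope S"
  shows "finite (facets S)"
proof -
  obtain X where X: "finite X" "S = convex hull X" using assms by (auto simp: polytope_def)
  have "facets S \<subseteq> (\<lambda>Y. convex hull Y) ` Pow X"
    using face_of_convex_hull_finite_eq[OF X(1)] by (auto simp: facets_def X(2))
  then show ?thesis using X(1) finite_subset by blast
qed

lemma face_of_linear_vimage: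
  assumes "linear f" "G face_of P" "f ` Q \<subseteq> P" "convex Q"
  shows "{z \<in> Q. f z \<in> G} face_of Q"
  unfolding face_of_def
proof (intro conjI ballI impI)
  have "convex (f -` G)" using assms(1,2) by (simp add: convex_linear_vimage face_of_imp_convex)
  moreover have "{z \<in> Q. f z \<in> G} = Q \<inter> f -` G" by blast
  ultimately show "convex {z \<in> Q. f z \<in> G}" using assms(4) by (simp add: convex_Int)
  fix a b z assume *: "a \<in> Q" "b \<in> Q" "z \<in> {z \<in> Q. f z \<in> G}" "z \<in> open_segment a b"
  interpret linear f by fact
  obtain u where u: "0 < u" "u < 1" "z = (1 - u) *\<^sub>R a + u *\<^sub>R b" using *(4) by (auto simp: in_segment)
  then have fz: "f z = (1 - u) *\<^sub>R f a + u *\<^sub>R f b" by (simp add: add scale)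
  have "f a \<in> G \<and> f b \<in> G"
  proof (cases "f a = f b")
    case True
    then have "f z = f a" using fz by (simp flip: scaleR_left_distrib)
    then show ?thesis using * True by simp
  next
    case False
    then have "f z \<in> open_segment (f a) (f b)" using fz u by (auto simp: in_segment)
    moreover have "f a \<in> P" "f b \<in> P" using * assms(3) by auto
    ultimately show ?thesis using assms(2) * unfolding face_of_def by blast
  qed
  then show "a \<in> {z \<in> Q. f z \<in> G}" "b \<in> {z \<in> Q. f z \<in> G}" using * by auto
qed auto

text \<open>
The number of facets at a single vertex already is the dimension. In dimension 0 the empty face
is a facet.
\<close>

lemma simple_polytope_size_bounds:
  assumes Q: "simple_polytope Q" "Q \<noteq> {}"
  shows "affdim Q \<le> int (polytope_size Q)" "0 < polytope_size Q"
proof -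
  have poly: "polytope Q" using Q(1) by (simp add: simple_polytope_def)
  note fin = finite_facets_polytope[OF poly]
  obtain v where "v extreme_point_of Q" using polytope_has_extreme_point[OF poly Q(2)] .
  then have "int (card {F \<in> facets Q. v \<in> F}) = affdim Q" using Q(1) by (simp add: simple_polytope_def)
  moreover have "card {F \<in> facets Q. v \<in> F} \<le> card (facets Q)" using fin by (intro card_mono) auto
  ultimately show le: "affdim Q \<le> int (polytope_size Q)" by (simp add: polytope_size_def)
  show "0 < polytope_size Q"
  proof (rule ccontr)
    assume "\<not> 0 < polytope_size Q"
    then have "facets Q = {}" "affdim Q \<le> 0" using fin le by (simp_all add: polytope_size_def)
    then have "affdim Q = 0" using Q(2) by (simp add: affdim_def)
    then have "{} \<in> facets Q" by (simp add: facets_def affdim_def)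
    then show False using \<open>facets Q = {}\<close> by blast
  qed
qed

section \<open>The facets at a vertex of a simple polytope\<close>

text \<open>
Each hyperplane lowers the dimension by at most one.
\<close>

lemma dim_Inter_hyperplanes:
  fixes L :: "'a::euclidean_space set"
  assumes "finite \<H>" "subspace L"
    and "\<And>H. H \<in> \<H> \<Longrightarrow> subspace H \<and> H \<subseteq> L \<and> dim L \<le> dim H + 1"
  shows "dim L \<le> dim (L \<inter> \<Inter>\<H>) + card \<H>"
  using assms
proof (induction \<H>)
  case empty
  then show ?case by simp
next
  case (insert H \<H>)
  let ?K = "L \<inter> \<Inter>\<H>"
  have K: "subspace ?K" using insert.prems by (intro subspace_inter subspace_Inter) auto
  have H: "subspace H" "H \<subseteq> L" "dim L \<le> dim H + 1" using insert.prems by auto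
  have "dim {x + y |x y. x \<in> ?K \<and> y \<in> H} \<le> dim L"
    using H insert.prems(1) by (intro dim_subset) (auto intro: subspace_add)
  then have "dim ?K + dim H \<le> dim L + dim (?K \<inter> H)"
    using dim_sums_Int[OF K H(1)] by linarith
  moreover have "dim L \<le> dim ?K + card \<H>" using insert by auto
  moreover have "?K \<inter> H = L \<inter> \<Inter>(insert H \<H>)" by blast
  ultimately show ?case using H insert.hyps by simp
qed

text \<open>
At a vertex of a \<open>d\<close>-dimensional simple polytope, the \<open>d - 1\<close> facets other than \<open>\<Phi>\<close> still share a
direction \<open>y\<close>, because each of them costs at most one dimension. Since the vertex is extreme, \<open>y\<close> leaves
\<open>\<Phi>\<close>, and up to its sign it points along the edge of \<open>Q\<close> that is opposite to \<open>\<Phi>\<close>.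
\<close>

lemma simple_vertex_edge_off_facet:
  fixes Q :: "'a::euclidean_space set"
  assumes Q: "polyhedron Q" and q: "q extreme_point_of Q"
    and fin: "finite {F. F facet_of Q \<and> q \<in> F}"
    and simple: "int (card {F. F facet_of Q \<and> q \<in> F}) \<le> aff_dim Q"
    and \<Phi>: "\<Phi> facet_of Q" "q \<in> \<Phi>"
  obtains z where "z \<in> Q" "z \<notin> \<Phi>" "\<And>F. F facet_of Q \<Longrightarrow> q \<in> F \<Longrightarrow> F \<noteq> \<Phi> \<Longrightarrow> z \<in> F"
proof -
  have qQ: "q \<in> Q" using q by (simp add: extreme_point_of_def)
  obtain H where H: "finite H" "Q = affine hull Q \<inter> \<Inter>H"
      "\<forall>h\<in>H. \<exists>a b. a \<noteq> 0 \<and> h = {x. a \<bullet> x \<le> b}"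
      "\<And>H'. H' \<subset> H \<Longrightarrow> Q \<subset> affine hull Q \<inter> \<Inter>H'"
    using Q unfolding polyhedron_Int_affine_minimal by blast
  then obtain a b where ab: "\<And>h. h \<in> H \<Longrightarrow> a h \<noteq> 0 \<and> h = {x. a h \<bullet> x \<le> b h}" by metis
  note facet = facet_of_polyhedron_explicit[OF H(1,2) ab H(4)]
  have le: "a h \<bullet> x \<le> b h" if "h \<in> H" "x \<in> Q" for h x
    using that ab H(2) by blast
  \<comment> \<open>All directions are taken relative to \<open>q\<close>: \<open>L\<close> is the direction space of \<open>Q\<close>, and \<open>D F\<close> that of a face \<open>F\<close> through \<open>q\<close>.\<close>
  define L where "L = (\<lambda>x. x - q) ` (affine hull Q)"
  define D where "D F = (\<lambda>x. x - q) ` (affine hull F)" for F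
  let ?B = "{F. F facet_of Q \<and> q \<in> F} - {\<Phi>}"
  have sub: "subspace ((\<lambda>x. x - q) ` (affine hull S))" and
    dim: "int (dim ((\<lambda>x. x - q) ` (affine hull S))) = aff_dim S" if "q \<in> S" for S
  proof -
    have qS: "q \<in> affine hull S" using that by (simp add: hull_inc)
    have "(\<lambda>x. x - q) ` (affine hull S) = (\<lambda>x. - q + x) ` (affine hull S)" by simp
    then show "subspace ((\<lambda>x. x - q) ` (affine hull S))"
      using affine_diffs_subspace[OF affine_affine_hull qS] by simp
    show "int (dim ((\<lambda>x. x - q) ` (affine hull S))) = aff_dim S"
      using aff_dim_eq_dim_subtract[of q "affine hull S"] qS
      by (simp add: hull_inc aff_dim_affine_hull)
  qed
  have "dim L \<le> dim (L \<inter> \<Inter>(D ` ?B)) + card (D ` ?B)"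
  proof (rule dim_Inter_hyperplanes)
    show "finite (D ` ?B)" using fin by simp
    show "subspace L" unfolding L_def by (rule sub[OF qQ])
    fix S assume "S \<in> D ` ?B"
    then obtain F where F: "F facet_of Q" "q \<in> F" "S = D F" by blast
    have "D F \<subseteq> L" unfolding D_def L_def
      using F(1) by (intro image_mono hull_mono) (simp add: facet_of_imp_subset)
    moreover have "int (dim L) = int (dim (D F)) + 1"
      using F dim[OF qQ] dim[OF F(2)] by (simp add: D_def L_def facet_of_def)
    ultimately show "subspace S \<and> S \<subseteq> L \<and> dim L \<le> dim S + 1"
      using F sub[OF F(2)] by (simp add: D_def)
  qed
  moreover have "card (D ` ?B) < dim L"
  proof -
    have "card (D ` ?B) \<le> card ?B" using fin by (intro card_image_le) simp
    also have "\<dots> < card {F. F facet_of Q \<and> q \<in> F}" using \<Phi> fin by (intro psubset_card_mono) auto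
    also have "\<dots> \<le> dim L" using simple dim[OF qQ] by (simp add: L_def)
    finally show ?thesis .
  qed
  ultimately have "dim (L \<inter> \<Inter>(D ` ?B)) \<noteq> 0" by linarith
  then obtain y where y: "y \<in> L" "y \<noteq> 0" "\<And>F. F \<in> ?B \<Longrightarrow> y \<in> D F"
    unfolding dim_eq_0 by auto
  \<comment> \<open>Moving along \<open>y\<close> keeps every inequality tight at \<open>q\<close> tight, except those that define \<open>\<Phi>\<close>.\<close>
  have orth: "a h \<bullet> y = 0" if h: "h \<in> H" "a h \<bullet> q = b h" "Q \<inter> {x. a h \<bullet> x = b h} \<noteq> \<Phi>" for h
  proof -
    let ?F = "Q \<inter> {x. a h \<bullet> x = b h}"
    have "?F facet_of Q" using facet h(1) by blast
    then have "y \<in> D ?F" using y(3) h qQ by simp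
    moreover have "affine hull ?F \<subseteq> {x. a h \<bullet> x = b h}"
      by (intro hull_minimal) (auto simp: affine_hyperplane)
    ultimately show ?thesis using h(2) by (auto simp: D_def inner_diff_right)
  qed
  \<comment> \<open>Inequalities that are slack at \<open>q\<close> survive a step of length \<open>e\<close>.\<close>
  have small: "\<exists>e>0. \<forall>h\<in>H. a h \<bullet> q < b h \<longrightarrow> e * \<bar>a h \<bullet> y\<bar> \<le> b h - a h \<bullet> q"
  proof -
    have "\<exists>e>0. \<forall>h\<in>K. a h \<bullet> q < b h \<longrightarrow> e * \<bar>a h \<bullet> y\<bar> \<le> b h - a h \<bullet> q" if "finite K" for K
      using that
    proof (induction K)
      case empty
      show ?case by (intro exI[of _ 1]) auto
    next
      case (insert k K)
      then obtain e where e: "e > 0" "\<And>h. h \<in> K \<Longrightarrow> a h \<bullet> q < b h \<Longrightarrow> e * \<bar>a h \<bullet> y\<bar> \<le> b h - a h \<bullet> q"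
        by blast
      define e' where "e' = (if a k \<bullet> q < b k then min e ((b k - a k \<bullet> q) / (1 + \<bar>a k \<bullet> y\<bar>)) else e)"
      have pos: "1 + \<bar>a k \<bullet> y\<bar> > 0" by (smt (verit) abs_ge_zero)
      have e': "0 < e'" "e' \<le> e" using e(1) pos by (auto simp: e'_def)
      have "e' * \<bar>a k \<bullet> y\<bar> \<le> b k - a k \<bullet> q" if k: "a k \<bullet> q < b k"
      proof -
        have "e' * \<bar>a k \<bullet> y\<bar> \<le> e' * (1 + \<bar>a k \<bullet> y\<bar>)" using e'(1) by (intro mult_left_mono) auto
        also have "\<dots> \<le> (b k - a k \<bullet> q) / (1 + \<bar>a k \<bullet> y\<bar>) * (1 + \<bar>a k \<bullet> y\<bar>)"
          using k pos by (intro mult_right_mono) (auto simp: e'_def)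
        also have "\<dots> = b k - a k \<bullet> q" using pos by simp
        finally show ?thesis .
      qed
      moreover have "e' * \<bar>a h \<bullet> y\<bar> \<le> b h - a h \<bullet> q" if "h \<in> K" "a h \<bullet> q < b h" for h
      proof -
        have "e' * \<bar>a h \<bullet> y\<bar> \<le> e * \<bar>a h \<bullet> y\<bar>" using e' by (intro mult_right_mono) auto
        with e(2)[OF that] show ?thesis by linarith
      qed
      ultimately show ?case using e' by blast
    qed
    then show ?thesis using H(1) by blast
  qed
  then obtain e where e: "e > 0" "\<And>h. h \<in> H \<Longrightarrow> a h \<bullet> q < b h \<Longrightarrow> e * \<bar>a h \<bullet> y\<bar> \<le> b h - a h \<bullet> q"
    by blast
  have aff: "q + t *\<^sub>R y \<in> affine hull S" if "y \<in> D S" "q \<in> S" for t S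
  proof -
    have "t *\<^sub>R y \<in> D S" unfolding D_def
      using sub[OF that(2)] that(1) by (simp add: D_def subspace_scale)
    then show ?thesis by (auto simp: D_def)
  qed
  have inQ: "q + t *\<^sub>R y \<in> Q"
    if t: "\<bar>t\<bar> = e" "\<And>h. h \<in> H \<Longrightarrow> a h \<bullet> q = b h \<Longrightarrow> t * (a h \<bullet> y) \<le> 0" for t
  proof -
    have "a h \<bullet> (q + t *\<^sub>R y) \<le> b h" if h: "h \<in> H" for h
    proof (cases "a h \<bullet> q = b h")
      case True
      then show ?thesis using t(2)[OF h] by (simp add: inner_add_right)
    next
      case False
      then have "\<bar>t\<bar> * \<bar>a h \<bullet> y\<bar> \<le> b h - a h \<bullet> q" using e(2)[OF h] le[OF h qQ] t(1) by simp
      then have "t * (a h \<bullet> y) \<le> b h - a h \<bullet> q" using abs_ge_self[of "t * (a h \<bullet> y)"] by (simp add: abs_mult)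
      then show ?thesis by (simp add: inner_add_right)
    qed
    then have "q + t *\<^sub>R y \<in> \<Inter>H" using ab by blast
    moreover have "q + t *\<^sub>R y \<in> affine hull Q" using aff[of Q t] y(1) qQ by (simp add: D_def L_def)
    ultimately show ?thesis using H(2) by blast
  qed
  obtain k where k: "k \<in> H" "\<Phi> = Q \<inter> {x. a k \<bullet> x = b k}" using facet \<Phi>(1) by blast
  have kq: "a k \<bullet> q = b k" using k \<Phi>(2) by blast
  have act: "a h \<bullet> y = 0 \<or> Q \<inter> {x. a h \<bullet> x = b h} = \<Phi>" if "h \<in> H" "a h \<bullet> q = b h" for h
    using orth that by blast
  \<comment> \<open>Several half-spaces might define \<open>\<Phi>\<close>. To see that all of them increase or all decrease along \<open>y\<close>, write \<open>y\<close> modulo \<open>D \<Phi>\<close> as a multiple \<open>c\<close> of the direction to a point of \<open>Q\<close> off \<open>\<Phi>\<close>.\<close>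
  obtain z0 where z0: "z0 \<in> Q" "z0 \<notin> \<Phi>"
    using \<Phi>(1) facet_of_imp_subset[OF \<Phi>(1)] by (metis facet_of_irrefl subsetI subset_antisym)
  have "\<exists>c. y - c *\<^sub>R (z0 - q) \<in> D \<Phi>"
  proof -
    have "affine hull \<Phi> \<subseteq> {x. a k \<bullet> x = b k}"
      unfolding k(2) by (intro hull_minimal) (auto simp: affine_hyperplane)
    then have z0D: "z0 - q \<notin> D \<Phi>" using k(2) z0 by (auto simp: D_def)
    have sD: "subspace (D \<Phi>)" using sub[OF \<Phi>(2)] by (simp add: D_def)
    let ?S = "span (insert (z0 - q) (D \<Phi>))"
    have "?S \<subseteq> L"
    proof (rule span_minimal)
      have "D \<Phi> \<subseteq> L" unfolding D_def L_def
        using \<Phi>(1) by (intro image_mono hull_mono) (simp add: facet_of_imp_subset)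
      moreover have "z0 - q \<in> L" using z0(1) by (simp add: L_def hull_inc)
      ultimately show "insert (z0 - q) (D \<Phi>) \<subseteq> L" by simp
      show "subspace L" unfolding L_def by (rule sub[OF qQ])
    qed
    moreover have "dim L \<le> dim ?S"
    proof -
      have "dim ?S = dim (D \<Phi>) + 1"
        using z0D sD by (simp add: dim_insert span_eq_iff[THEN iffD2])
      moreover have "int (dim L) = int (dim (D \<Phi>)) + 1"
        using \<Phi> dim[OF qQ] dim[OF \<Phi>(2)] by (simp add: D_def L_def facet_of_def)
      ultimately show ?thesis by linarith
    qed
    ultimately have "?S = L"
      using subspace_dim_equal[of ?S L] sub[OF qQ] by (simp add: L_def)
    then have "y \<in> ?S" using y(1) by simp
    then show ?thesis using sD by (simp add: span_breakdown_eq span_eq_iff[THEN iffD2])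
  qed
  then obtain c where c: "y - c *\<^sub>R (z0 - q) \<in> D \<Phi>" by blast
  have onD: "a h \<bullet> x = 0" if "h \<in> H" "a h \<bullet> q = b h" "x \<in> D (Q \<inter> {x. a h \<bullet> x = b h})" for h x
  proof -
    have "affine hull (Q \<inter> {x. a h \<bullet> x = b h}) \<subseteq> {x. a h \<bullet> x = b h}"
      by (intro hull_minimal) (auto simp: affine_hyperplane)
    then show ?thesis using that by (auto simp: D_def inner_diff_right)
  qed
  have val: "a h \<bullet> y = c * (a h \<bullet> z0 - b h)"
    if "h \<in> H" "a h \<bullet> q = b h" "Q \<inter> {x. a h \<bullet> x = b h} = \<Phi>" for h
    using onD[of h "y - c *\<^sub>R (z0 - q)"] that c by (simp add: inner_diff_right)
  have nonpos: "t * (a h \<bullet> y) \<le> 0" if "h \<in> H" "a h \<bullet> q = b h" "0 \<le> t * c" for h t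
  proof (cases "Q \<inter> {x. a h \<bullet> x = b h} = \<Phi>")
    case True
    have "t * c * (a h \<bullet> z0 - b h) \<le> 0"
      using that(3) le[OF that(1) z0(1)] by (simp add: mult_nonneg_nonpos)
    then show ?thesis using val[OF that(1,2) True] by (simp add: mult.assoc)
  qed (use orth that in simp)
  \<comment> \<open>Otherwise one could move both ways along \<open>y\<close> within \<open>Q\<close>, and \<open>q\<close> would not be extreme.\<close>
  have "c \<noteq> 0"
  proof
    assume "c = 0"
    then have in2: "q + s *\<^sub>R y \<in> Q" if "\<bar>s\<bar> = e" for s
      using that nonpos[of _ s] by (intro inQ) auto
    have "q + e *\<^sub>R y \<in> Q" "q + (- e) *\<^sub>R y \<in> Q" using e(1) by (intro in2; simp)+
    moreover have "q \<in> open_segment (q + e *\<^sub>R y) (q + (- e) *\<^sub>R y)"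
    proof -
      have "q + e *\<^sub>R y \<noteq> q + (- e) *\<^sub>R y"
      proof -
        have "q + e *\<^sub>R y - (q + (- e) *\<^sub>R y) = (e - - e) *\<^sub>R y"
          by (simp only: add_diff_cancel_left scaleR_left_diff_distrib)
        moreover have "(e - - e) *\<^sub>R y \<noteq> 0" using e(1) y(2) by simp
        ultimately show ?thesis by fastforce
      qed
      moreover have "q = (1 - 1/2) *\<^sub>R (q + e *\<^sub>R y) + (1/2) *\<^sub>R (q + (- e) *\<^sub>R y)"
        by (simp add: scaleR_right_distrib scaleR_right_diff_distrib flip: scaleR_left_distrib)
      ultimately show ?thesis unfolding in_segment by (intro conjI exI[of _ "1/2"]) auto
    qed
    ultimately show False using q by (auto simp: extreme_point_of_def)
  qed
  define t where "t = e * sgn c"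
  have t: "\<bar>t\<bar> = e" "0 < t * c"
    using e(1) \<open>c \<noteq> 0\<close> by (auto simp: t_def abs_mult mult.assoc sgn_mult_self_eq zero_less_mult_iff sgn_if)
  show thesis
  proof (rule that)
    show "q + t *\<^sub>R y \<in> Q" using t nonpos[of _ t] by (intro inQ) auto
    have "a k \<bullet> z0 < b k" using le[OF k(1) z0(1)] z0 k(2) by auto
    then have "t * (a k \<bullet> y) < 0"
      using val[OF k(1) kq] k(2) t(2) by (simp add: mult.assoc[symmetric] mult_pos_neg)
    then show "q + t *\<^sub>R y \<notin> \<Phi>" using kq by (auto simp: k(2) inner_add_right)
    fix F assume F: "F facet_of Q" "q \<in> F" "F \<noteq> \<Phi>"
    then obtain h where h: "h \<in> H" "F = Q \<inter> {x. a h \<bullet> x = b h}" using facet by blast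
    then have "a h \<bullet> q = b h" using F(2) by blast
    with orth[OF h(1) this] h F(3) \<open>q + t *\<^sub>R y \<in> Q\<close> show "q + t *\<^sub>R y \<in> F"
      by (simp add: inner_add_right)
  qed
qed

text \<open>
This is the only consequence of simplicity that the lower bound uses. A face through \<open>q\<close> is the
intersection of the facets above it; if \<open>\<Phi>\<close> is not one of these, the face contains the edge at
\<open>q\<close> that leaves \<open>\<Phi>\<close>. Two such faces share that edge.
\<close>

lemma simple_vertex_prime_facet:
  fixes Q :: "'a::euclidean_space set"
  assumes Q: "polyhedron Q" and q: "q extreme_point_of Q"
    and fin: "finite {F. F facet_of Q \<and> q \<in> F}"
    and simple: "int (card {F. F facet_of Q \<and> q \<in> F}) \<le> aff_dim Q"
    and \<Phi>: "\<Phi> facet_of Q" "q \<in> \<Phi>"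
    and G: "G1 face_of Q" "G2 face_of Q" "q \<in> G1" "q \<in> G2" "G1 \<inter> G2 \<subseteq> \<Phi>"
  shows "G1 \<subseteq> \<Phi> \<or> G2 \<subseteq> \<Phi>"
proof (rule ccontr)
  assume neg: "\<not> (G1 \<subseteq> \<Phi> \<or> G2 \<subseteq> \<Phi>)"
  obtain z where z: "z \<in> Q" "z \<notin> \<Phi>" "\<And>F. F facet_of Q \<Longrightarrow> q \<in> F \<Longrightarrow> F \<noteq> \<Phi> \<Longrightarrow> z \<in> F"
    using simple_vertex_edge_off_facet[OF Q q fin simple \<Phi>] by metis
  have "z \<in> G" if "G face_of Q" "q \<in> G" "\<not> G \<subseteq> \<Phi>" for G
  proof (cases "G = Q")
    case False
    then have "G = \<Inter>{F. F facet_of Q \<and> G \<subseteq> F}"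
      using that by (intro face_of_polyhedron[OF Q]) auto
    moreover have "z \<in> F" if "F facet_of Q" "G \<subseteq> F" for F
      using z(3)[OF that(1)] that(2) \<open>q \<in> G\<close> \<open>\<not> G \<subseteq> \<Phi>\<close> by blast
    ultimately show ?thesis by blast
  qed (use z in simp)
  then show False using neg G z(2) by blast
qed

section \<open>A lower bound for simple extensions\<close>

text \<open>
The lower bound principle. Suppose that every \<open>w\<close> in \<open>W\<close> has a companion \<open>x\<close> such that some
face \<open>E\<close> contains both, while each further point of \<open>W\<close> shares with \<open>x\<close> a face meeting \<open>E\<close>
only in \<open>x\<close>. Then for every \<open>w\<close> there is a facet of the simple extension that contains the preimages
of all points of \<open>W\<close> but \<open>w\<close>. Different \<open>w\<close> need different facets.
\<close>

theorem simple_extension_size_ge: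
  fixes Q :: "'a::euclidean_space set" and P :: "'b::real_vector set"
  assumes Q: "simple_polytope Q" and ext: "extension_via Q \<pi> P" and W: "W \<subseteq> P"
    and sep: "\<And>w. w \<in> W \<Longrightarrow> \<exists>x E. x \<in> W \<and> x \<noteq> w \<and> E face_of P \<and> x \<in> E \<and> w \<in> E \<and>
      (\<forall>x'\<in>W - {w}. \<exists>E'. E' face_of P \<and> x \<in> E' \<and> x' \<in> E' \<and> E \<inter> E' = {x})"
  shows "card W \<le> polytope_size Q"
proof -
  have poly: "polytope Q" and lin: "linear \<pi>" and im: "\<pi> ` Q = P"
    using ext by (auto simp: extension_via_def)
  then have ph: "polyhedron Q" and cv: "convex Q"
    by (auto simp: polytope_imp_polyhedron polytope_imp_convex)
  define pre where "pre G = {z \<in> Q. \<pi> z \<in> G}" for G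
  have face: "pre G face_of Q" if "G face_of P" for G
    unfolding pre_def using face_of_linear_vimage[OF lin that _ cv] im by simp
  have ne: "pre {w} \<noteq> {}" if "w \<in> W" for w using that W im by (auto simp: pre_def)
  have fac: "F \<in> facets Q" if "F facet_of Q" for F
    using that by (simp add: facets_def facet_of_def affdim_eq_aff_dim)
  have facq: "{F. F facet_of Q \<and> q \<in> F} = {F \<in> facets Q. q \<in> F}" for q
    by (auto simp: facets_def facet_of_def affdim_eq_aff_dim)
  have "\<exists>\<Phi>\<in>facets Q. \<forall>x\<in>W. pre {x} \<subseteq> \<Phi> \<longleftrightarrow> x \<noteq> w" if w: "w \<in> W" for w
  proof -
    obtain x E where x: "x \<in> W" "x \<noteq> w" and E: "E face_of P" "x \<in> E" "w \<in> E"
      and E': "\<And>x'. x' \<in> W \<Longrightarrow> x' \<noteq> w \<Longrightarrow> \<exists>E'. E' face_of P \<and> x \<in> E' \<and> x' \<in> E' \<and> E \<inter> E' = {x}"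
      using sep[OF w] by blast
    have "{x} face_of P" using E'[OF x] E(1) face_of_Int by metis
    then have fx: "pre {x} face_of Q" by (rule face)
    have disj: "pre {x} \<inter> pre {w} = {}" using x(2) by (auto simp: pre_def)
    \<comment> \<open>The face over \<open>x\<close> is an intersection of facets, and it misses the face over \<open>w\<close>; so one of these facets does not contain the latter.\<close>
    have "pre {x} \<noteq> Q" using ne[OF w] disj by (auto simp: pre_def)
    then have "pre {x} = \<Inter>{F. F facet_of Q \<and> pre {x} \<subseteq> F}"
      using face_of_polyhedron[OF ph fx ne[OF x(1)]] by blast
    then obtain \<Phi> where \<Phi>: "\<Phi> facet_of Q" "pre {x} \<subseteq> \<Phi>" "\<not> pre {w} \<subseteq> \<Phi>"
      using disj ne[OF w] by blast
    obtain q where q: "q extreme_point_of pre {x}"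
      using polytope_has_extreme_point[OF face_of_polytope_polytope[OF poly fx] ne[OF x(1)]] .
    then have qQ: "q extreme_point_of Q" and qx: "q \<in> pre {x}"
      using extreme_point_of_face[OF fx] by auto
    \<comment> \<open>The faces over \<open>E\<close> and \<open>E'\<close> meet in the face over \<open>x\<close>, which lies in \<open>\<Phi>\<close>; as \<open>\<Phi>\<close> does not contain the face over \<open>E\<close>, it contains the one over \<open>E'\<close>.\<close>
    have "pre {x'} \<subseteq> \<Phi>" if x': "x' \<in> W" "x' \<noteq> w" for x'
    proof -
      obtain E' where E': "E' face_of P" "x \<in> E'" "x' \<in> E'" "E \<inter> E' = {x}" using E'[OF x'] by blast
      have "pre E \<subseteq> \<Phi> \<or> pre E' \<subseteq> \<Phi>"
      proof (rule simple_vertex_prime_facet[OF ph qQ _ _ \<Phi>(1) _ face[OF E(1)] face[OF E'(1)]])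
        show "finite {F. F facet_of Q \<and> q \<in> F}"
          using finite_facets_polytope[OF poly] by (simp add: facq)
        show "int (card {F. F facet_of Q \<and> q \<in> F}) \<le> aff_dim Q"
          using Q qQ by (simp add: facq simple_polytope_def affdim_eq_aff_dim)
        show "q \<in> \<Phi>" using qx \<Phi>(2) by blast
        show "q \<in> pre E" "q \<in> pre E'" using qx E(2) E'(2) by (auto simp: pre_def)
        show "pre E \<inter> pre E' \<subseteq> \<Phi>" using E'(4) \<Phi>(2) by (auto simp: pre_def)
      qed
      moreover have "\<not> pre E \<subseteq> \<Phi>" using \<Phi>(3) E(3) by (auto simp: pre_def)
      ultimately show ?thesis using E'(3) by (auto simp: pre_def)
    qed
    then show ?thesis using \<Phi> fac by blast
  qed
  then obtain \<Phi> where \<Phi>: "\<And>w. w \<in> W \<Longrightarrow> \<Phi> w \<in> facets Q"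
      "\<And>w x. w \<in> W \<Longrightarrow> x \<in> W \<Longrightarrow> pre {x} \<subseteq> \<Phi> w \<longleftrightarrow> x \<noteq> w" by metis
  have "inj_on \<Phi> W" using \<Phi>(2) by (metis inj_onI)
  then show ?thesis
    unfolding polytope_size_def using \<Phi>(1) finite_facets_polytope[OF poly]
    by (intro card_inj_on_le[of \<Phi>]) auto
qed

section \<open>Simple extensions in spaces of finitely supported sequences\<close>

lemma simple_polytope_linear_image_cancel:
  fixes f :: "'a::real_vector \<Rightarrow> 'b::real_vector"
  assumes f: "linear f" "inj f" and Q: "simple_polytope (f ` S)"
  shows "simple_polytope S"
  unfolding simple_polytope_def
proof (intro conjI allI impI)
  obtain Y where Y: "finite Y" "f ` S = convex hull Y"
    using Q by (auto simp: simple_polytope_def polytope_def)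
  then have "Y \<subseteq> f ` S" by (simp add: hull_subset)
  then obtain X where X: "Y = f ` X" by (rule subset_imageE)
  then have "f ` S = f ` (convex hull X)" using Y f(1) by (simp add: convex_hull_linear_image)
  then have "S = convex hull X" using f(2) by (simp add: inj_image_eq_iff)
  moreover have "finite X" using X Y(1) f(2) by (metis finite_imageD inj_on_subset subset_UNIV)
  ultimately show "polytope S" by (auto simp: polytope_def)
  fix v assume v: "v extreme_point_of S"
  then have "f v extreme_point_of f ` S"
    using f by (auto simp: extreme_point_of_def open_segment_linear_image inj_image_mem_iff)
  then have "int (card {F \<in> facets (f ` S). f v \<in> F}) = affdim (f ` S)"
    using Q by (simp add: simple_polytope_def)
  moreover have "{F \<in> facets (f ` S). f v \<in> F} = (`) f ` {F \<in> facets S. v \<in> F}"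
    using inj_image_mem_iff[OF f(2)] by (simp add: facets_linear_image[OF f]) blast
  moreover have "inj_on ((`) f) {F \<in> facets S. v \<in> F}"
    using f(2) by (simp add: inj_on_def inj_image_eq_iff)
  ultimately show "int (card {F \<in> facets S. v \<in> F}) = affdim S"
    by (simp add: card_image affdim_linear_image[OF f])
qed

lemma infinite_extend_basis_poly_mapping:
  assumes B: "independent (B :: (nat \<Rightarrow>\<^sub>0 real) set)"
  shows "infinite (extend_basis B)"
proof
  assume fin: "finite (extend_basis B)"
  \<comment> \<open>Finitely many sequences all vanish at some position \<open>k\<close>, and then so does their span.\<close>
  have "finite (\<Union>p\<in>extend_basis B. Poly_Mapping.keys p)" using fin by simp
  then obtain k where k: "k \<notin> (\<Union>p\<in>extend_basis B. Poly_Mapping.keys p)"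
    using ex_new_if_finite[OF infinite_UNIV_nat] by blast
  let ?Z = "{p :: nat \<Rightarrow>\<^sub>0 real. Poly_Mapping.lookup p k = 0}"
  have "subspace ?Z" by (simp add: subspace_def lookup_add lookup_scaleR_real)
  moreover have "extend_basis B \<subseteq> ?Z" using k by (auto simp: in_keys_iff)
  ultimately have "span (extend_basis B) \<subseteq> ?Z" by (rule span_minimal[rotated])
  then have "Poly_Mapping.single k 1 \<in> ?Z" using span_extend_basis[OF B] by blast
  then show False by simp
qed

text \<open>
A polytope of sequences whose dimension is smaller than that of a given Euclidean space has a
linearly isomorphic copy there. This brings the theory of polyhedra in Euclidean spaces to bear on
the polytopes over which \<^const>\<open>sxc\<close> ranges. Embedding the Euclidean space, rather than projecting
the polytope, yields a map that is injective everywhere, as the transfer of facets requires.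
\<close>

lemma polytope_in_euclidean_copy:
  fixes Q :: "(nat \<Rightarrow>\<^sub>0 real) set"
  assumes Q: "polytope Q" and d: "affdim Q < int DIM('a::euclidean_space)"
  obtains j :: "'a::euclidean_space \<Rightarrow> (nat \<Rightarrow>\<^sub>0 real)" where "linear j" "inj j" "Q \<subseteq> range j"
proof -
  obtain X where X: "finite X" "Q = convex hull X" using Q by (auto simp: polytope_def)
  let ?D = "{x - y |x y. x \<in> Q \<and> y \<in> Q}"
  obtain B where B: "B \<subseteq> ?D" "independent B" "?D \<subseteq> span B"
    using real_vector.maximal_independent_subset by blast
  have "Q \<subseteq> span X" unfolding X(2) by (rule convex_hull_subset_span)
  then have "B \<subseteq> span X" using B(1) by (auto intro!: span_diff)
  then have finB: "finite B" using independent_span_bound[OF X(1) B(2)] by simp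
  \<comment> \<open>The linear span exceeds the direction space by at most one dimension.\<close>
  obtain A where A: "Q \<subseteq> span A" "finite A" "card A \<le> DIM('a)"
  proof (cases "Q = {}")
    case False
    then obtain a where a: "a \<in> Q" by blast
    have "Q \<subseteq> span (insert a B)"
    proof
      fix x assume "x \<in> Q"
      then have "x - a \<in> span B" using B(3) a by blast
      then show "x \<in> span (insert a B)" by (auto simp: span_breakdown_eq intro!: exI[of _ 1])
    qed
    moreover have "int (card B) = affdim Q"
      using B a real_vector.dim_unique[OF B(1,3,2) refl] by (auto simp: affdim_def)
    moreover have "card (insert a B) \<le> card B + 1" using finB by (simp add: card_insert_if)
    ultimately show thesis using d finB by (intro that[of "insert a B"]) auto
  qed (use that[of "{}"] in simp)
  obtain B' where B': "B' \<subseteq> A" "independent B'" "A \<subseteq> span B'"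
    using real_vector.maximal_independent_subset by blast
  have finB': "finite B'" using B'(1) A(2) finite_subset by blast
  have cB': "card B' \<le> DIM('a)" using card_mono[OF A(2) B'(1)] A(3) by simp
  \<comment> \<open>Extra basis vectors make the dimensions agree, so that \<open>j\<close> can be injective on the whole space.\<close>
  let ?E = "extend_basis B'"
  have "infinite (?E - B')" using infinite_extend_basis_poly_mapping[OF B'(2)] finB' by simp
  then obtain T where T: "T \<subseteq> ?E - B'" "finite T" "card T = DIM('a) - card B'"
    using infinite_arbitrarily_large by metis
  define C where "C = B' \<union> T"
  have C: "independent C" "finite C" "card C = card (Basis :: 'a set)"
  proof -
    show "independent C"
    proof (rule independent_mono[OF independent_extend_basis[OF B'(2)]])
      show "C \<subseteq> ?E" using T(1) extend_basis_superset[OF B'(2)] by (auto simp: C_def)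
    qed
    show "finite C" using T finB' by (simp add: C_def)
    show "card C = card (Basis :: 'a set)"
      unfolding C_def using T finB' cB' by (subst card_Un_disjoint) auto
  qed
  then obtain h where h: "bij_betw h (Basis :: 'a set) C"
    using finite_same_card_bij[of "Basis :: 'a set" C] by auto
  obtain j where j: "linear j" "\<And>b. b \<in> Basis \<Longrightarrow> j b = h b"
    using linear_independent_extend[OF independent_Basis, of h] by blast
  have im: "j ` Basis = C" using h j(2) by (auto simp: bij_betw_def)
  have "inj_on j (span Basis)"
  proof (rule linear_inj_on_span_independent_image[OF j(1)])
    show "independent (j ` Basis)" using im C(1) by simp
    show "inj_on j Basis" using h j(2) by (auto simp: bij_betw_def inj_on_def)
  qed
  then have "inj j" by simp
  moreover have "range j = span C"
    using linear_span_image[OF j(1), of Basis] im by simp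
  moreover have "Q \<subseteq> span C"
  proof -
    have "A \<subseteq> span C" using B'(3) span_mono[of B' C] by (auto simp: C_def)
    then show ?thesis using A(1) span_minimal[OF _ subspace_span] by blast
  qed
  ultimately show thesis using that[OF j(1)] by simp
qed

text \<open>
A least number with a property has the property only if some number does; any simple extension in
a Euclidean space provides one, after embedding.
\<close>

lemma sxc_attained:
  fixes Q :: "'a::euclidean_space set"
  assumes Q: "simple_polytope Q" and ext: "extension_via Q \<pi> P"
  obtains Q' :: "(nat \<Rightarrow>\<^sub>0 real) set" and \<pi>'
  where "simple_polytope Q'" "extension_via Q' \<pi>' P" "polytope_size Q' = sxc P"
proof -
  obtain j :: "'a \<Rightarrow> (nat \<Rightarrow>\<^sub>0 real)" where j: "linear j" "inj j"
  proof (rule polytope_in_euclidean_copy[of "{}"])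
    show "affdim ({} :: (nat \<Rightarrow>\<^sub>0 real) set) < int DIM('a)" by (simp add: affdim_def)
    show "polytope ({} :: (nat \<Rightarrow>\<^sub>0 real) set)"
      unfolding polytope_def by (intro exI[of _ "{}"]) simp
  qed
  obtain g where g: "linear g" "g \<circ> j = id"
    using linear_injective_left_inverse[OF j] by blast
  have s: "simple_polytope (j ` Q)" by (rule simple_polytope_linear_image[OF j Q])
  have "(\<pi> \<circ> g) ` (j ` Q) = P"
    using ext g(2) by (simp add: image_image extension_via_def fun_eq_iff)
  moreover have "linear (\<pi> \<circ> g)"
    using ext g(1) by (auto simp: extension_via_def intro: linear_compose)
  ultimately have "extension_via (j ` Q) (\<pi> \<circ> g) P"
    using s by (simp add: extension_via_def simple_polytope_def)
  with s have "\<exists>k Q' \<pi>'. simple_polytope (Q' :: (nat \<Rightarrow>\<^sub>0 real) set) \<and> extension_via Q' \<pi>' P \<and>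
      polytope_size Q' = k" by blast
  from LeastI_ex[OF this] show thesis unfolding sxc_def[symmetric] using that by blast
qed

section \<open>The simplex as a simple extension\<close>

lemma simple_polytope_simplex:
  fixes S :: "'a::euclidean_space set"
  assumes S: "\<not> affine_dependent S"
  shows "simple_polytope (convex hull S)" "polytope_size (convex hull S) = card S"
proof -
  have fin: "finite S" using S by (rule aff_independent_finite)
  have dim: "affdim (convex hull C) = int (card C) - 1" if "C \<subseteq> S" for C
    using aff_dim_affine_independent[OF affine_independent_subset[OF S that]]
    by (simp add: affdim_eq_aff_dim aff_dim_convex_hull)
  have mem: "v \<in> convex hull C \<longleftrightarrow> v \<in> C" if "C \<subseteq> S" "v \<in> S" for C v
  proof
    assume "v \<in> convex hull C"
    moreover have "v \<notin> convex hull (S - {v})"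
      using S that(2) convex_hull_subset_affine_hull unfolding affine_dependent_def by blast
    ultimately show "v \<in> C" using hull_mono[of C "S - {v}" convex] that(1) by blast
  qed (simp add: hull_inc)
  let ?f = "\<lambda>u. convex hull (S - {u})"
  have facets: "facets (convex hull S) = ?f ` S"
  proof (intro set_eqI iffI)
    fix F assume "F \<in> facets (convex hull S)"
    then obtain C where C: "C \<subseteq> S" "F = convex hull C" "int (card C) = int (card S) - 1"
      using face_of_convex_hull_affine_independent[OF S] dim by (auto simp: facets_def)
    then have "card (S - C) = 1" using fin by (simp add: card_Diff_subset finite_subset)
    then obtain u where "S - C = {u}" by (auto simp: card_1_singleton_iff)
    then have "u \<in> S" "C = S - {u}" using C(1) by auto
    then show "F \<in> ?f ` S" using C(2) by blast
  next
    fix F assume "F \<in> ?f ` S"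
    then obtain u where u: "u \<in> S" "F = ?f u" by blast
    have "card S \<ge> 1" using u(1) fin by (metis One_nat_def Suc_leI card_gt_0_iff empty_iff)
    then show "F \<in> facets (convex hull S)"
      using u dim[of "S - {u}"] dim[of S] face_of_convex_hull_affine_independent[OF S]
      by (auto simp: facets_def card_Diff_singleton of_nat_diff)
  qed
  have inj: "inj_on ?f S"
    using mem by (intro inj_onI) (metis DiffE DiffI Diff_subset insertI1 singletonD)
  show "polytope_size (convex hull S) = card S"
    unfolding polytope_size_def facets by (rule card_image[OF inj])
  show "simple_polytope (convex hull S)"
    unfolding simple_polytope_def
  proof (intro conjI allI impI)
    show "polytope (convex hull S)" using fin by (auto simp: polytope_def)
    fix v assume "v extreme_point_of convex hull S"
    then have v: "v \<in> S" by (rule extreme_point_of_convex_hull)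
    have "{F \<in> facets (convex hull S). v \<in> F} = ?f ` (S - {v})"
      unfolding facets using mem v by auto
    then have "card {F \<in> facets (convex hull S). v \<in> F} = card (S - {v})"
      using card_image[OF inj_on_subset[OF inj]] by auto
    moreover have "card S \<ge> 1" using v fin by (metis One_nat_def Suc_leI card_gt_0_iff empty_iff)
    ultimately show "int (card {F \<in> facets (convex hull S). v \<in> F}) = affdim (convex hull S)"
      using v dim[of S] by (simp add: card_Diff_singleton of_nat_diff)
  qed
qed

lemma simplex_extension:
  fixes c :: "'i::finite \<Rightarrow> 'b::real_vector"
  obtains Q :: "(real ^ 'i) set" and \<pi>
  where "simple_polytope Q" "extension_via Q \<pi> (convex hull (c ` S))" "polytope_size Q \<le> card S"
proof -
  let ?A = "(\<lambda>i. axis i (1::real)) ` S"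
  have "?A \<subseteq> Basis" by (auto simp: axis_in_Basis_iff)
  then have "\<not> affine_dependent ?A"
    using independent_mono[OF independent_Basis] affine_dependent_imp_dependent by blast
  note simplex = simple_polytope_simplex[OF this]
  define \<pi> where "\<pi> y = (\<Sum>i\<in>UNIV. (y $ i) *\<^sub>R c i)" for y :: "real ^ 'i"
  have lin: "linear \<pi>"
    unfolding \<pi>_def
    by (intro linearI) (simp_all add: scaleR_left_distrib sum.distrib scaleR_sum_right)
  have "\<pi> (axis i 1) = c i" for i
  proof -
    have "\<pi> (axis i 1) = (\<Sum>k\<in>UNIV. if k = i then c k else 0)"
      unfolding \<pi>_def by (intro sum.cong) (auto simp: axis_def)
    then show ?thesis by simp
  qed
  then have "\<pi> ` (convex hull ?A) = convex hull (c ` S)"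
    by (simp add: convex_hull_linear_image[OF lin] image_image)
  then have "extension_via (convex hull ?A) \<pi> (convex hull (c ` S))"
    using simplex(1) lin by (simp add: extension_via_def simple_polytope_def)
  moreover have "polytope_size (convex hull ?A) \<le> card S"
    unfolding simplex(2) by (rule card_image_le) simp
  ultimately show thesis using that simplex(1) by blast
qed

section \<open>Perfect matchings of complete graphs\<close>

lemma perfect_matching_complete_iff:
  "perfect_matching V (complete_edges V) M \<longleftrightarrow>
     (\<forall>e\<in>M. e \<subseteq> V \<and> card e = 2) \<and> (\<forall>v\<in>V. \<exists>!e. e \<in> M \<and> v \<in> e)"
  by (auto simp: perfect_matching_def complete_edges_def)

abbreviation pm where "pm V M \<equiv> perfect_matching V (complete_edges V) M"

lemma pm_edge: "pm V M \<Longrightarrow> e \<in> M \<Longrightarrow> e \<subseteq> V \<and> card e = 2"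
  by (auto simp: perfect_matching_complete_iff)

lemma pm_cover: "pm V M \<Longrightarrow> v \<in> V \<Longrightarrow> \<exists>e. e \<in> M \<and> v \<in> e"
  unfolding perfect_matching_complete_iff by blast

lemma pm_insert:
  assumes "pm V M" "a \<notin> V" "b \<notin> V" "a \<noteq> b"
  shows "pm (insert a (insert b V)) (insert {a,b} M)"
  unfolding perfect_matching_complete_iff
proof (intro conjI ballI)
  show "e \<subseteq> insert a (insert b V)" "card e = 2" if "e \<in> insert {a, b} M" for e
    using assms that by (auto simp: perfect_matching_complete_iff)
  fix v assume "v \<in> insert a (insert b V)"
  then consider "v \<in> {a,b}" | "v \<in> V" "v \<notin> {a,b}" by blast
  then show "\<exists>!e. e \<in> insert {a, b} M \<and> v \<in> e"
  proof cases
    case 1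
    with assms show ?thesis
      by (intro ex1I[of _ "{a,b}"]) (auto simp: perfect_matching_complete_iff)
  next
    case 2
    then have "\<exists>!e. e \<in> M \<and> v \<in> e" using assms by (auto simp: perfect_matching_complete_iff)
    then show ?thesis using 2 by auto
  qed
qed

lemma pm_edges_disjoint:
  assumes "pm V M" "e \<in> M" "f \<in> M" "v \<in> e" "v \<in> f"
  shows "e = f"
proof -
  have "v \<in> V" using assms by (auto simp: perfect_matching_complete_iff)
  then show ?thesis using assms unfolding perfect_matching_complete_iff by blast
qed

lemma pm_remove:
  assumes M: "pm V M" and e: "e \<in> M"
  shows "pm (V - e) (M - {e})"
  unfolding perfect_matching_complete_iff
proof (intro conjI ballI)
  show "f \<subseteq> V - e" "card f = 2" if "f \<in> M - {e}" for f
    using that M pm_edges_disjoint[OF M e, of f] by (auto simp: perfect_matching_complete_iff)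
  fix v assume v: "v \<in> V - e"
  then have "\<exists>!f. f \<in> M \<and> v \<in> f" using M by (auto simp: perfect_matching_complete_iff)
  then show "\<exists>!f. f \<in> M - {e} \<and> v \<in> f" using v by auto
qed

lemma pm_subset_eq:
  assumes "pm V M" "pm V N" "M \<subseteq> N"
  shows "M = N"
proof (rule subset_antisym[OF assms(3)], rule subsetI)
  fix e assume e: "e \<in> N"
  then have "e \<subseteq> V" "card e = 2" using pm_edge[OF assms(2)] by auto
  then obtain v where v: "v \<in> e" "v \<in> V" by (cases "e = {}") auto
  then obtain f where "f \<in> M" "v \<in> f" using pm_cover[OF assms(1)] by blast
  then show "e \<in> M"
    using pm_edges_disjoint[OF assms(2) e, of f v] assms(3) v by blast
qed

lemma pm_mate:
  assumes "pm V M" "a \<in> V"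
  obtains b where "b \<in> V" "b \<noteq> a" "{a,b} \<in> M"
proof -
  obtain e where e: "e \<in> M" "a \<in> e" using pm_cover[OF assms] by blast
  then have "card e = 2" "e \<subseteq> V" using pm_edge[OF assms(1)] by auto
  then obtain b where "e = {a,b}" "a \<noteq> b" using e unfolding card_2_iff by blast
  with e \<open>e \<subseteq> V\<close> that show ?thesis by blast
qed

lemma pm_empty [simp]: "pm {} M \<longleftrightarrow> M = {}"
  by (auto simp: perfect_matching_complete_iff)

lemma pms_expand:
  assumes a: "a \<in> V"
  shows "{M. pm V M} = (\<Union>b\<in>V - {a}. insert {a,b} ` {M. pm (V - {a,b}) M})"
proof (intro set_eqI iffI)
  fix M assume "M \<in> {M. pm V M}"
  then have M: "pm V M" by simp
  then obtain b where b: "b \<in> V" "b \<noteq> a" "{a,b} \<in> M" using a by (rule pm_mate)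
  then have "M = insert {a,b} (M - {{a,b}})" by blast
  with b pm_remove[OF M b(3)] show "M \<in> (\<Union>b\<in>V - {a}. insert {a,b} ` {M. pm (V - {a,b}) M})"
    by blast
next
  fix M assume "M \<in> (\<Union>b\<in>V - {a}. insert {a,b} ` {M. pm (V - {a,b}) M})"
  then obtain b N where b: "b \<in> V" "b \<noteq> a" and N: "pm (V - {a,b}) N" "M = insert {a,b} N" by blast
  have "insert a (insert b (V - {a,b})) = V" using a b by blast
  with pm_insert[OF N(1), of a b] N(2) b show "M \<in> {M. pm V M}" by simp
qed

lemma finite_pms: "finite V \<Longrightarrow> finite {M. pm V M}"
  by (rule finite_subset[of _ "Pow (Pow V)"]) (auto simp: perfect_matching_complete_iff)

text \<open>
Stated over the naturals to avoid division. Among \<open>2 n + 2\<close> nodes, \<open>a\<close> has \<open>2 n + 1\<close> possible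
partners, and what is left is a perfect matching of the other \<open>2 n\<close> nodes.
\<close>

lemma card_pms:
  assumes "finite V" "card V = 2 * n"
  shows "card {M. pm V M} * (fact n * 2 ^ n) = (fact (2 * n) :: nat)"
  using assms
proof (induction n arbitrary: V)
  case 0
  then show ?case by simp
next
  case (Suc n)
  then obtain a where a: "a \<in> V" by fastforce
  let ?B = "\<lambda>b. insert {a,b} ` {M. pm (V - {a,b}) M}"
  have notin: "{a,b} \<notin> N" if "pm (V - {a,b}) N" for b N
    using pm_edge[OF that, of "{a,b}"] by blast
  have card1: "card (?B b) * (fact n * 2 ^ n) = fact (2 * n)" if "b \<in> V - {a}" for b
  proof -
    have "inj_on (insert {a,b}) {M. pm (V - {a,b}) M}"
      using notin by (intro inj_onI) (metis insert_ident mem_Collect_eq)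
    moreover have "card (V - {a,b}) = 2 * n"
      using that a Suc.prems by (subst card_Diff_subset) auto
    ultimately show ?thesis using Suc.IH[of "V - {a,b}"] Suc.prems by (simp add: card_image)
  qed
  \<comment> \<open>The partner of \<open>a\<close> can be read off the matching.\<close>
  have disj: "?B b \<inter> ?B c = {}" if "b \<in> V - {a}" "c \<in> V - {a}" "b \<noteq> c" for b c
  proof (rule ccontr)
    assume "?B b \<inter> ?B c \<noteq> {}"
    then obtain M where "M \<in> ?B b" "M \<in> ?B c" by blast
    then obtain N N' where "M = insert {a,b} N" "M = insert {a,c} N'" by (elim imageE)
    then have "{a,b} \<in> M" "{a,c} \<in> M" by (metis insertI1)+
    moreover have "pm V M" using \<open>M \<in> ?B b\<close> that(1) pms_expand[OF a] by blast
    ultimately have "{a,b} = {a,c}" by (intro pm_edges_disjoint[of V M _ _ a]) auto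
    with that show False by (auto simp: doubleton_eq_iff)
  qed
  have "card {M. pm V M} = (\<Sum>b\<in>V - {a}. card (?B b))"
    unfolding pms_expand[OF a] using Suc.prems disj
    by (intro card_UN_disjoint) (auto intro!: finite_imageI finite_pms)
  then have "card {M. pm V M} * (fact n * 2 ^ n) = (\<Sum>b\<in>V - {a}. card (?B b) * (fact n * 2 ^ n))"
    by (simp add: sum_distrib_right)
  also have "\<dots> = (\<Sum>b\<in>V - {a}. fact (2 * n))" by (intro sum.cong card1 refl)
  also have "\<dots> = (2 * n + 1) * fact (2 * n)" using Suc.prems a by simp
  finally have "card {M. pm V M} * (fact n * 2 ^ n) * (2 * n + 2) =
      (2 * n + 2) * ((2 * n + 1) * fact (2 * n))" by simp
  then show ?case by (simp add: algebra_simps)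
qed

text \<open>
The union \<open>x \<union> w\<close> is a Hamiltonian cycle, grown by inserting the edges of \<open>w\<close> one at a time. On two
nodes this cycle degenerates to a double edge, and the induction starts from there. The last
conjunct is adjacency of \<open>x\<close> and \<open>w\<close> on the polytope; it is the form in which the
cycle is used, so cycles need not be formalised.
\<close>

lemma ex_disjoint_adjacent_pm:
  assumes "finite V" "card V = 2 * n" "n \<ge> 1" "pm V w"
  shows "\<exists>x. pm V x \<and> (n = 1 \<and> x = w \<or> x \<inter> w = {}) \<and> (\<forall>M. pm V M \<and> M \<subseteq> x \<union> w \<longrightarrow> M = x \<or> M = w)"
  using assms(3,1,2,4)
proof (induction n arbitrary: V w rule: nat_induct_at_least)
  case base
  then have "M = w" if "pm V M" "M \<subseteq> w \<union> w" for M
    using that pm_subset_eq[of V M w] by simp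
  with base show ?case by (intro exI[of _ w]) auto
next
  case (Suc n)
  then obtain a where a: "a \<in> V" by fastforce
  obtain b where b: "b \<in> V" "b \<noteq> a" "{a,b} \<in> w" using Suc.prems(3) a by (rule pm_mate)
  let ?V = "V - {a,b}" let ?w = "w - {{a,b}}"
  have cV: "card ?V = 2 * n" using a b Suc.prems by (subst card_Diff_subset) auto
  have w: "pm ?V ?w" using Suc.prems(3) b(3) by (rule pm_remove)
  obtain y where y: "pm ?V y" "n = 1 \<and> y = ?w \<or> y \<inter> ?w = {}"
      "\<And>M. pm ?V M \<Longrightarrow> M \<subseteq> y \<union> ?w \<Longrightarrow> M = y \<or> M = ?w"
    using Suc.IH[of ?V ?w] Suc.prems(1) cV w by auto
  obtain p where p: "p \<in> ?V"
    using cV Suc.hyps by (metis card.empty ex_in_conv mult_eq_0_iff not_one_le_zero zero_neq_numeral)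
  obtain q where q: "q \<in> ?V" "q \<noteq> p" "{p,q} \<in> y" using y(1) p by (rule pm_mate)
  \<comment> \<open>Replacing the edge \<open>pq\<close> of the cycle by the path \<open>p a b q\<close> makes it pass through \<open>ab\<close>, which is an edge of \<open>w\<close>.\<close>
  let ?x = "insert {a,p} (insert {b,q} (y - {{p,q}}))"
  \<comment> \<open>In the base of the induction \<open>y\<close> equals \<open>?w\<close> and is the single edge \<open>pq\<close>, which the construction removes.\<close>
  have disj: "?w = y \<or> {p,q} \<notin> ?w" and dj: "(y - {{p,q}}) \<inter> ?w = {}"
  proof -
    show "?w = y \<or> {p,q} \<notin> ?w" using y(2) q(3) by blast
    show "(y - {{p,q}}) \<inter> ?w = {}"
    proof (cases "n = 1 \<and> y = ?w")
      case True
      then have "card ?V = card {p,q}" using cV q by simp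
      then have "?V = {p,q}" using p q Suc.prems(1) by (metis card_subset_eq empty_subsetI finite_Diff insert_subset)
      then have "pm {} (y - {{p,q}})" using pm_remove[OF y(1) q(3)] by (metis Diff_cancel)
      then have "y - {{p,q}} = {}" by simp
      then show ?thesis by blast
    qed (use y(2) in blast)
  qed
  have "pm (?V - {p,q}) (y - {{p,q}})" using y(1) q(3) by (rule pm_remove)
  from pm_insert[OF this, of b q] q b p
  have "pm (insert b (insert q (?V - {p,q}))) (insert {b,q} (y - {{p,q}}))" by blast
  from pm_insert[OF this, of a p] a b p q
  have "pm (insert a (insert p (insert b (insert q (?V - {p,q}))))) ?x" by blast
  moreover have "insert a (insert p (insert b (insert q (?V - {p,q})))) = V" using a b p q by blast
  ultimately have x: "pm V ?x" by simp
  have wV: "e \<subseteq> ?V" if "e \<in> ?w" for e using pm_edge[OF w that] by blast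
  have yV: "e \<subseteq> ?V" if "e \<in> y" for e using pm_edge[OF y(1) that] by blast
  have xw: "?x \<inter> w = {}"
  proof -
    have "{a,p} \<notin> ?w" "{b,q} \<notin> ?w" using wV by blast+
    moreover have "{a,p} \<noteq> {a,b}" "{b,q} \<noteq> {a,b}" using p q by (auto simp: doubleton_eq_iff)
    moreover have "{a,b} \<notin> y" using yV by blast
    ultimately show ?thesis using dj by blast
  qed
  have uniq: "M = ?x \<or> M = w" if M: "pm V M" "M \<subseteq> ?x \<union> w" for M
  proof (cases "{a,b} \<in> M")
    case True
    have "pm ?V (M - {{a,b}})" using M(1) True by (rule pm_remove)
    have "{a,p} \<notin> M" "{b,q} \<notin> M"
      using pm_edges_disjoint[OF M(1) True, of "{a,p}" a] pm_edges_disjoint[OF M(1) True, of "{b,q}" b] p q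
      by (auto simp: doubleton_eq_iff)
    with M(2) have sub: "M - {{a,b}} \<subseteq> (y - {{p,q}}) \<union> ?w" by auto
    then have "M - {{a,b}} = y \<or> M - {{a,b}} = ?w" using y(3) \<open>pm ?V (M - {{a,b}})\<close> by blast
    then have "M - {{a,b}} = ?w" using sub disj q(3) by blast
    then show ?thesis using True b(3) by blast
  next
    case False
    have Mcases: "e = {a,p} \<or> e = {b,q} \<or> e \<in> y \<or> e \<in> ?w" if "e \<in> M" for e
      using subsetD[OF M(2) that] that False by blast
    \<comment> \<open>Without \<open>ab\<close>, the only edges that can cover \<open>a\<close> and \<open>b\<close> are \<open>ap\<close> and \<open>bq\<close>; replacing them by \<open>pq\<close> gives a matching that the induction hypothesis applies to.\<close>
    have ap: "{a,p} \<in> M"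
    proof -
      obtain c where c: "{a,c} \<in> M" using M(1) a by (rule pm_mate)
      have "{a,c} \<notin> ?w" "{a,c} \<notin> y" using wV yV by blast+
      moreover have "{a,c} \<noteq> {b,q}" using b q by (auto simp: doubleton_eq_iff)
      ultimately have "{a,c} = {a,p}" using Mcases[OF c] by metis
      then show ?thesis using c by simp
    qed
    have bq: "{b,q} \<in> M"
    proof -
      obtain c where c: "{b,c} \<in> M" using M(1) b(1) by (rule pm_mate)
      have "{b,c} \<notin> ?w" "{b,c} \<notin> y" using wV yV by blast+
      moreover have "{b,c} \<noteq> {a,p}" using b p by (auto simp: doubleton_eq_iff)
      ultimately have "{b,c} = {b,q}" using Mcases[OF c] by metis
      then show ?thesis using c by simp
    qed
    have ne: "{b,q} \<noteq> {a,p}" using b p by (auto simp: doubleton_eq_iff)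
    let ?N = "M - {{a,p}} - {{b,q}}"
    have N: "pm (V - {a,p} - {b,q}) ?N"
      using pm_remove[OF pm_remove[OF M(1) ap], of "{b,q}"] bq ne by blast
    have "pm (insert p (insert q (V - {a,p} - {b,q}))) (insert {p,q} ?N)"
      using pm_insert[OF N, of p q] q by blast
    moreover have "insert p (insert q (V - {a,p} - {b,q})) = ?V" using a b p q by blast
    ultimately have N': "pm ?V (insert {p,q} ?N)" by simp
    have "?N \<subseteq> y \<union> ?w"
    proof
      fix e assume "e \<in> ?N"
      then show "e \<in> y \<union> ?w" using Mcases[of e] by blast
    qed
    then have "insert {p,q} ?N \<subseteq> y \<union> ?w" using q(3) by simp
    then have "insert {p,q} ?N = y \<or> insert {p,q} ?N = ?w" by (rule y(3)[OF N'])
    then have Ny: "insert {p,q} ?N = y" using disj by (metis insertI1)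
    have "{p,q} \<notin> ?N" using pm_edge[OF N, of "{p,q}"] by blast
    then have "?N = y - {{p,q}}" using Ny by (metis Diff_insert_absorb)
    then have "?x = insert {a,p} (insert {b,q} ?N)" by simp
    also have "\<dots> = M"
    proof -
      have "insert c (insert d (M - {c} - {d})) = M" if "c \<in> M" "d \<in> M" for c d
        using that by blast
      then show ?thesis using ap bq .
    qed
    finally show ?thesis by simp
  qed
  have "Suc n = 1 \<and> ?x = w \<or> ?x \<inter> w = {}" using xw by (rule disjI2)
  moreover have "\<forall>M. pm V M \<and> M \<subseteq> ?x \<union> w \<longrightarrow> M = ?x \<or> M = w"
    using uniq by (intro allI impI) (elim conjE)
  ultimately show ?case using x by (intro exI[of _ ?x] conjI)
qed

section \<open>The perfect matching polytope of a complete graph\<close>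

lemma inj_char_vec: "inj char_vec"
  by (auto simp: inj_def char_vec_def vec_eq_iff split: if_splits)

abbreviation pmp :: "'v::finite set \<Rightarrow> (real ^ ('v set)) set" where
  "pmp V \<equiv> perfect_matching_polytope V (complete_edges V)"

definition matching_face :: "'v::finite set \<Rightarrow> 'v set set \<Rightarrow> (real ^ ('v set)) set" where
  "matching_face V E = {p \<in> pmp V. \<forall>e. e \<notin> E \<longrightarrow> p $ e = 0}"

text \<open>
All coordinates are nonnegative on the polytope, so the vanishing of some of them amounts to the
minimality of their sum.
\<close>

lemma matching_face_of:
  fixes V :: "'v::finite set"
  shows "matching_face V E face_of pmp V"
proof -
  have "pmp V \<subseteq> {p. \<forall>e. 0 \<le> p $ e}"
    unfolding perfect_matching_polytope_def
    by (rule hull_minimal) (auto simp: char_vec_def convex_def)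
  then have nonneg: "0 \<le> p $ e" if "p \<in> pmp V" for p e using that by blast
  have inner: "char_vec (- E) \<bullet> p = (\<Sum>e\<in>- E. p $ e)" for p :: "real ^ ('v set)"
    by (auto simp: inner_vec_def char_vec_def intro!: sum.mono_neutral_cong_right)
  have "convex (pmp V)" by (simp add: perfect_matching_polytope_def)
  moreover have "0 \<le> char_vec (- E) \<bullet> p" if "p \<in> pmp V" for p
    using nonneg[OF that] by (simp add: inner sum_nonneg)
  ultimately have "pmp V \<inter> {p. char_vec (- E) \<bullet> p = 0} face_of pmp V"
    by (rule face_of_Int_supporting_hyperplane_ge)
  moreover have "pmp V \<inter> {p. char_vec (- E) \<bullet> p = 0} = matching_face V E"
    unfolding matching_face_def inner using nonneg by (auto simp: sum_nonneg_eq_0_iff)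
  ultimately show ?thesis by simp
qed

lemma char_vec_in_pmp: "pm V M \<Longrightarrow> char_vec M \<in> pmp V"
  by (simp add: perfect_matching_polytope_def hull_inc)

lemma char_vec_in_matching_face: "pm V M \<Longrightarrow> M \<subseteq> E \<Longrightarrow> char_vec M \<in> matching_face V E"
  using char_vec_in_pmp[of V M] by (auto simp: matching_face_def) (auto simp: char_vec_def)

lemma matching_face_eq: "matching_face V E = convex hull (char_vec ` {M. pm V M \<and> M \<subseteq> E})"
proof -
  have "char_vec ` {M. pm V M} \<inter> matching_face V E = char_vec ` {M. pm V M \<and> M \<subseteq> E}"
    by (auto simp: matching_face_def char_vec_in_pmp) (auto simp: char_vec_def split: if_splits)
  then show ?thesis
    using face_of_convex_hull_finite_eq[of "char_vec ` {M. pm V M}" "matching_face V E"]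
      matching_face_of[of V E] by (simp add: perfect_matching_polytope_def)
qed

lemma matching_face_singleton:
  assumes "pm V x" "x \<subseteq> E" "\<And>M. pm V M \<Longrightarrow> M \<subseteq> E \<Longrightarrow> M = x"
  shows "matching_face V E = {char_vec x}"
proof -
  have "{M. pm V M \<and> M \<subseteq> E} = {x}" using assms by blast
  then show ?thesis by (simp add: matching_face_eq)
qed

lemma extreme_points_pmp: "{p. p extreme_point_of pmp V} = char_vec ` {M. pm V M}"
proof (intro set_eqI iffI)
  fix p assume "p \<in> {p. p extreme_point_of pmp V}"
  then show "p \<in> char_vec ` {M. pm V M}"
    unfolding perfect_matching_polytope_def using extreme_point_of_convex_hull by blast
next
  fix p assume "p \<in> char_vec ` {M. pm V M}"
  then obtain M where M: "pm V M" "p = char_vec M" by blast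
  have "{p} = matching_face V M"
    using matching_face_singleton[OF M(1), of M] pm_subset_eq M by blast
  then show "p \<in> {p. p extreme_point_of pmp V}"
    using matching_face_of[of V M] by (simp flip: face_of_singleton)
qed

text \<open>
The companion of \<open>w\<close> is a matching \<open>x\<close> such that \<open>x \<union> w\<close> is a Hamiltonian cycle, and the faces are
those spanned by the matchings within \<open>x \<union> w\<close> and within \<open>x \<union> u\<close>. The first consists of \<open>x\<close> and
\<open>w\<close> only, and the second omits \<open>w\<close>: as \<open>w\<close> shares no edge with \<open>x\<close>, it would have to be
contained in \<open>u\<close>.
\<close>

lemma pmp_extension_size_ge:
  fixes V :: "'v::finite set" and Q :: "'a::euclidean_space set"
  assumes V: "card V = 2 * n" "n \<ge> 2" and Q: "simple_polytope Q" "extension_via Q \<pi> (pmp V)"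
  shows "card {M. pm V M} \<le> polytope_size Q"
proof -
  let ?W = "char_vec ` {M. pm V M}"
  have "card ?W \<le> polytope_size Q"
  proof (rule simple_extension_size_ge[OF Q])
    show "?W \<subseteq> pmp V" using char_vec_in_pmp by blast
    fix p assume "p \<in> ?W"
    then obtain w where w: "pm V w" "p = char_vec w" by blast
    obtain x where x: "pm V x" "x \<inter> w = {}"
      and adj: "\<And>M. pm V M \<Longrightarrow> M \<subseteq> x \<union> w \<Longrightarrow> M = x \<or> M = w"
      using ex_disjoint_adjacent_pm[OF _ V(1) _ w(1)] V(2) by auto
    have ne: "x \<noteq> w"
    proof
      assume "x = w"
      then have "x = {}" using x(2) by blast
      moreover have "V \<noteq> {}" using V by auto
      ultimately show False using pm_cover[OF x(1)] by blast
    qed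
    have "\<exists>E'. E' face_of pmp V \<and> char_vec x \<in> E' \<and> y \<in> E' \<and>
        matching_face V (x \<union> w) \<inter> E' = {char_vec x}" if y: "y \<in> ?W - {p}" for y
    proof -
      obtain u where u: "pm V u" "y = char_vec u" "u \<noteq> w" using y w(2) by blast
      have "matching_face V (x \<union> w) \<inter> matching_face V (x \<union> u) =
          matching_face V ((x \<union> w) \<inter> (x \<union> u))"
        by (auto simp: matching_face_def)
      also have "\<dots> = {char_vec x}"
      proof (rule matching_face_singleton[OF x(1)])
        fix M assume M: "pm V M" "M \<subseteq> (x \<union> w) \<inter> (x \<union> u)"
        then have "M = x \<or> M = w" using adj by blast
        moreover have "M \<noteq> w"
        proof
          assume "M = w"
          then have "w \<subseteq> u" using M(2) x(2) by blast
          then show False using pm_subset_eq[OF w(1) u(1)] u(3) by blast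
        qed
        ultimately show "M = x" by blast
      qed blast
      finally show ?thesis
        using matching_face_of x(1) u by (intro exI[of _ "matching_face V (x \<union> u)"])
          (simp add: char_vec_in_matching_face)
    qed
    moreover have "char_vec x \<noteq> p" using ne inj_char_vec w(2) by (auto dest: injD)
    ultimately show "\<exists>x E. x \<in> ?W \<and> x \<noteq> p \<and> E face_of pmp V \<and> x \<in> E \<and> p \<in> E \<and>
      (\<forall>x'\<in>?W - {p}. \<exists>E'. E' face_of pmp V \<and> x \<in> E' \<and> x' \<in> E' \<and> E \<inter> E' = {x})"
      using x(1) w matching_face_of[of V "x \<union> w"]
      by (intro exI[of _ "char_vec x"] exI[of _ "matching_face V (x \<union> w)"] conjI)
        (auto simp: char_vec_in_matching_face)
  qed
  then show ?thesis by (simp add: card_image inj_on_subset[OF inj_char_vec])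
qed

theorem theorem7p1:
  fixes V :: "'v::finite set" and n :: nat
  assumes "n \<ge> 1" and "card V = 2 * n"
  defines "P \<equiv> perfect_matching_polytope V (complete_edges V)"
  shows "sxc P = card {x. x extreme_point_of P} \<and>
    real (card {x. x extreme_point_of P}) = fact (2 * n) / (fact n * 2 ^ n)"
proof -
  let ?N = "card {M. pm V M}"
  have N: "card {x. x extreme_point_of P} = ?N"
    unfolding P_def extreme_points_pmp by (rule card_image) (rule inj_on_subset[OF inj_char_vec], simp)
  have count: "?N * (fact n * 2 ^ n) = fact (2 * n)" using card_pms[OF _ assms(2)] by simp
  then have "real ?N * (fact n * 2 ^ n) = fact (2 * n)"
    by (metis of_nat_fact of_nat_mult of_nat_numeral of_nat_power)
  then have real: "real ?N = fact (2 * n) / (fact n * 2 ^ n)" by (simp add: field_simps)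
  obtain Q0 :: "(real ^ ('v set set)) set" and \<pi>0
    where Q0: "simple_polytope Q0" "extension_via Q0 \<pi>0 P" "polytope_size Q0 \<le> ?N"
    unfolding P_def perfect_matching_polytope_def by (rule simplex_extension)
  have le: "sxc P \<le> ?N" using sxc_le[OF Q0(1,2)] Q0(3) by simp
  have "?N > 0" using count by (metis fact_nonzero mult_0 not_gr_zero)
  then have "P \<noteq> {}" using char_vec_in_pmp by (force simp: P_def card_gt_0_iff)
  have ge: "?N \<le> polytope_size Q"
    if Q: "simple_polytope Q" "extension_via Q \<pi> P" for Q :: "(nat \<Rightarrow>\<^sub>0 real) set" and \<pi>
  proof (rule ccontr)
    assume "\<not> ?N \<le> polytope_size Q"
    then have less: "polytope_size Q < ?N" by simp
    have "Q \<noteq> {}" using Q(2) \<open>P \<noteq> {}\<close> by (auto simp: extension_via_def)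
    note pos = simple_polytope_size_bounds[OF Q(1) this]
    \<comment> \<open>For \<open>n = 1\<close> there is one matching, and \<open>Q\<close> has at least one facet, if only the empty one.\<close>
    have "n \<noteq> 1" using count pos(2) less by auto
    then have n: "n \<ge> 2" using assms(1) by simp
    have poly: "polytope Q" using Q(1) by (simp add: simple_polytope_def)
    \<comment> \<open>This Euclidean space is chosen only for its dimension: it is at least the number of perfect matchings, which exceeds the dimension of \<open>Q\<close>.\<close>
    have "?N \<le> CARD('v set set)" by (rule card_mono) simp_all
    then have "?N \<le> DIM(real ^ ('v set set))" by simp
    then have "affdim Q < int DIM(real ^ ('v set set))" using pos(1) less by linarith
    then obtain j :: "real ^ ('v set set) \<Rightarrow> (nat \<Rightarrow>\<^sub>0 real)"
      where j: "linear j" "inj j" "Q \<subseteq> range j" using polytope_in_euclidean_copy[OF poly] by blast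
    then obtain Q' where Q': "Q = j ` Q'" by (metis subset_imageE)
    have s: "simple_polytope Q'" using simple_polytope_linear_image_cancel[OF j(1,2)] Q(1) Q' by blast
    moreover have "extension_via Q' (\<pi> \<circ> j) P"
      using Q(2) s j(1) Q' linear_compose[OF j(1)]
      by (auto simp: extension_via_def simple_polytope_def image_image)
    ultimately have "?N \<le> polytope_size Q'"
      using pmp_extension_size_ge[OF assms(2) n] unfolding P_def by blast
    then show False using less polytope_size_linear_image[OF j(1,2)] Q' by simp
  qed
  have "?N \<le> sxc P" using sxc_attained[OF Q0(1,2)] ge by metis
  then show ?thesis using le N real by simp
qed

end
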